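(* Let $K$ be a non-Archimedean local field with normalized absolute value $|\cdot|_K$ and residue field of cardinality $q$, let $\alpha>0$, and let $a,f$ be continuous radial complex-valued functions on $K$ (i.e. $x\mapsto a(|x|_K)$, $x\mapsto f(|x|_K)$, with finite limits $a(0),f(0)$ as $x\to0$). Let $N\in\mathbb Z$ be such that $|q^{-\alpha}a(|x|_K)|x|_K^\alpha|<1$ for all $|x|_K\le q^N$, and let $B_N=\{x\in K:|x|_K\le q^N\}$. Put $c_\alpha=\frac{1-q^{-\alpha}}{1-q^{\alpha-1}}$ and, for $x\ne0$, $$k_\alpha(x,y)=\big[1+q^{-\alpha}a(|x|_K)|x|_K^\alpha\big]^{-1}c_\alpha a(|x|_K)\big(|x|_K^{\alpha-1}-|y|_K^{\alpha-1}\big)\quad(\alpha\ne1),$$ $$k_1(x,y)=\frac{1-q}{q\log q}\big[1+q^{-1}a(|x|_K)|x|_K\big]^{-1}a(|x|_K)\big(\log|x|_K-\log|y|_K\big),$$ for $|y|_K<|x|_K$, with $k_\alpha(0,y)=0$ and $k_\alpha(x,y)=0$ when $|y|_K\ge|x|_K$; and $F(|x|_K)=\big[1+q^{-\alpha}a(|x|_K)|x|_K^\alpha\big]^{-1}f(|x|_K)$. Then the integral equation $$v(|x|_K)+\int_{|y|_K<|x|_K}k_\alpha(x,y)\,v(|y|_K)\,dy=F(|x|_K),\qquad x\in B_N,$$ has a unique continuous solution on $B_N$.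
   Context: $K$ is a non-discrete totally disconnected locally compact field; $|\cdot|_K$ is normalized so that its nonzero values are $q^n$, $n\in\mathbb Z$, where $q$ is the cardinality of the residue field; $dy$ is the additive Haar measure with $\int_{|y|_K\le1}dy=1$. *)

theory Defs
  imports "HOL-Analysis.Analysis"
begin

text \<open>A non-Archimedean local field is modelled as a field type 'k together with
its normalized absolute value absv, the residue field cardinality q and the
normalized additive Haar measure M. The topology is the one induced by absv.\<close>

definition kdist :: "('k::field \<Rightarrow> real) \<Rightarrow> 'k \<Rightarrow> 'k \<Rightarrow> real" where
  "kdist absv x y = absv (x - y)"

definition ktop :: "('k::field \<Rightarrow> real) \<Rightarrow> 'k topology" where
  "ktop absv = Metric_space.mtopology UNIV (kdist absv)"

definition valring :: "('k::field \<Rightarrow> real) \<Rightarrow> 'k set" where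
  "valring absv = {x. absv x \<le> 1}"

definition residue_rel :: "('k::field \<Rightarrow> real) \<Rightarrow> ('k \<times> 'k) set" where
  "residue_rel absv = {(x, y). x \<in> valring absv \<and> y \<in> valring absv \<and> absv (x - y) < 1}"

definition nonarch_local_field :: "('k::field \<Rightarrow> real) \<Rightarrow> nat \<Rightarrow> 'k measure \<Rightarrow> bool" where
  "nonarch_local_field absv q M \<longleftrightarrow>
     \<comment> \<open>non-Archimedean absolute value\<close>
     (\<forall>x. absv x = 0 \<longleftrightarrow> x = 0) \<and>
     (\<forall>x y. absv (x * y) = absv x * absv y) \<and>
     (\<forall>x y. absv (x + y) \<le> max (absv x) (absv y)) \<and>
     \<comment> \<open>normalization: nonzero values are exactly the q^n, q = #residue field\<close>
     q \<ge> 2 \<and>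
     (\<forall>x. x \<noteq> 0 \<longrightarrow> (\<exists>n::int. absv x = real q powi n)) \<and>
     (\<exists>x. absv x = real q) \<and>
     card (valring absv // residue_rel absv) = q \<and>
     \<comment> \<open>local compactness of the induced topology\<close>
     compactin (ktop absv) (valring absv) \<and>
     \<comment> \<open>M is the additive Haar measure on the Borel sets, normalized on the unit ball\<close>
     space M = UNIV \<and>
     sets M = sigma_sets UNIV {U. openin (ktop absv) U} \<and>
     (\<forall>A \<in> sets M. \<forall>c. emeasure M ((\<lambda>y. c + y) ` A) = emeasure M A) \<and>
     emeasure M (valring absv) = 1"

definition c_alpha :: "nat \<Rightarrow> real \<Rightarrow> real" where
  "c_alpha q \<alpha> = (1 - real q powr (-\<alpha>)) / (1 - real q powr (\<alpha> - 1))"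

definition kern :: "('k::field \<Rightarrow> real) \<Rightarrow> nat \<Rightarrow> real \<Rightarrow> (real \<Rightarrow> complex) \<Rightarrow> 'k \<Rightarrow> 'k \<Rightarrow> complex" where
  "kern absv q \<alpha> a x y =
     (if x = 0 \<or> absv y \<ge> absv x then 0
      else if \<alpha> \<noteq> 1 then
        inverse (1 + of_real (real q powr (-\<alpha>)) * a (absv x) * of_real (absv x powr \<alpha>))
        * of_real (c_alpha q \<alpha>) * a (absv x)
        * of_real (absv x powr (\<alpha> - 1) - absv y powr (\<alpha> - 1))
      else
        of_real ((1 - real q) / (real q * ln (real q)))
        * inverse (1 + of_real (inverse (real q)) * a (absv x) * of_real (absv x))
        * a (absv x) * of_real (ln (absv x) - ln (absv y)))"

definition Fun :: "('k::field \<Rightarrow> real) \<Rightarrow> nat \<Rightarrow> real \<Rightarrow> (real \<Rightarrow> complex) \<Rightarrow> (real \<Rightarrow> complex) \<Rightarrow> real \<Rightarrow> complex" where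
  "Fun absv q \<alpha> a f r =
     inverse (1 + of_real (real q powr (-\<alpha>)) * a r * of_real (r powr \<alpha>)) * f r"

definition ball_N :: "('k::field \<Rightarrow> real) \<Rightarrow> nat \<Rightarrow> int \<Rightarrow> 'k set" where
  "ball_N absv q N = {x. absv x \<le> real q powi N}"

definition is_solution ::
  "('k::field \<Rightarrow> real) \<Rightarrow> nat \<Rightarrow> 'k measure \<Rightarrow> real \<Rightarrow> (real \<Rightarrow> complex) \<Rightarrow> (real \<Rightarrow> complex)
    \<Rightarrow> int \<Rightarrow> (real \<Rightarrow> complex) \<Rightarrow> bool" where
  "is_solution absv q M \<alpha> a f N v \<longleftrightarrow>
     continuous_map (subtopology (ktop absv) (ball_N absv q N)) euclidean (\<lambda>x. v (absv x)) \<and>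
     (\<forall>x \<in> ball_N absv q N.
        set_integrable M {y. absv y < absv x} (\<lambda>y. kern absv q \<alpha> a x y * v (absv y)) \<and>
        v (absv x) + (LINT y:{y. absv y < absv x}|M. kern absv q \<alpha> a x y * v (absv y))
          = Fun absv q \<alpha> a f (absv x))"

end

theory Submission
  imports Defs "HOL-Probability.Discrete_Topology"
begin

text \<open>A radial function is determined by its values at the radii \<open>q\<^bsup>k\<^esup>\<close> and at \<open>0\<close>, and it is
  continuous iff the values at \<open>q\<^bsup>k\<^esup>\<close> tend to the value at \<open>0\<close> for \<open>k \<rightarrow> -\<infinity>\<close>. With
  \<open>b = min \<alpha> 1 / 2\<close> the kernel satisfies \<open>|k(x,y)| \<le> D |x|\<^bsup>\<alpha>-b\<^esup> |y|\<^bsup>b-1\<^esup>\<close>, also in the logarithmic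
  case \<open>\<alpha> = 1\<close>. The balls of radius \<open>q\<^bsup>k\<^esup>\<close> have measure \<open>q\<^bsup>k\<^esup>\<close>, so integrating over
  \<open>|y| < |x|\<close> gives an operator of norm \<open>O(|x|\<^bsup>\<alpha>\<^esup>)\<close>, a contraction on bounded functions at small
  radii. Because the integral at \<open>x\<close> only involves radii strictly below \<open>|x|\<close>, the equation then
  determines the solution recursively, one radius at a time, up to \<open>q\<^bsup>N\<^esup>\<close>.\<close>

section \<open>The value group and the ultrametric inequality\<close>

locale local_field =
  fixes absv :: "'k::field \<Rightarrow> real" and q :: nat and M :: "'k measure"
  assumes local_field: "nonarch_local_field absv q M"
begin

lemma absv_eq_0_iff [simp]: "absv x = 0 \<longleftrightarrow> x = 0"
  and absv_mult: "absv (x * y) = absv x * absv y"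
  and absv_add_le: "absv (x + y) \<le> max (absv x) (absv y)"
  and q_ge_2: "q \<ge> 2"
  and ex_absv_eq_q: "\<exists>x. absv x = real q"
  and card_residue_field: "card (valring absv // residue_rel absv) = q"
  and space_M [simp]: "space M = UNIV"
  and sets_M: "sets M = sigma_sets UNIV {U. openin (ktop absv) U}"
  and emeasure_valring: "emeasure M (valring absv) = 1"
  using local_field unfolding nonarch_local_field_def by (elim conjE; iprover)+

lemma emeasure_translate: "A \<in> sets M \<Longrightarrow> emeasure M ((\<lambda>y. c + y) ` A) = emeasure M A"
  using local_field unfolding nonarch_local_field_def by (elim conjE; metis)

lemma absv_cases:
  obtains "x = 0" | n :: int where "absv x = real q powi n"
  using local_field unfolding nonarch_local_field_def by (elim conjE; metis)

lemma absv_0 [simp]: "absv 0 = 0"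
  by simp

lemma q_pos: "real q > 0" and q_gt_1: "real q > 1"
  using q_ge_2 by auto

lemma q_neq_0 [simp]: "q \<noteq> 0"
  using q_pos by simp

lemma absv_nonneg [simp]: "absv x \<ge> 0"
  by (cases x rule: absv_cases) (auto simp: q_pos)

lemma absv_pos_iff [simp]: "absv x > 0 \<longleftrightarrow> x \<noteq> 0"
  using absv_nonneg[of x] absv_eq_0_iff[of x] by linarith

lemma absv_1 [simp]: "absv 1 = 1"
  using absv_mult[of 1 1] absv_eq_0_iff[of 1] by simp

lemma absv_minus [simp]: "absv (- x) = absv x"
proof -
  have "absv (-1) * absv (-1) = 1"
    using absv_mult[of "-1" "-1"] by simp
  then have "absv (-1) = 1"
    using absv_nonneg[of "-1"] by (metis abs_of_nonneg abs_1 abs_mult_self_eq power2_eq_square power2_eq_1_iff real_sqrt_abs)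
  then show ?thesis
    using absv_mult[of "-1" x] by simp
qed

lemma absv_diff_le: "absv (x - y) \<le> max (absv x) (absv y)"
  using absv_add_le[of x "- y"] by simp

lemma absv_minus_commute: "absv (x - y) = absv (y - x)"
  using absv_minus[of "x - y"] by simp

text \<open>Writing y = x - (x - y) bounds |y| by |x|, and writing x = (x - y) + y rules out |y| <
  |x|.\<close>

lemma absv_eq_of_close: "absv (x - y) < absv x \<Longrightarrow> absv y = absv x"
  using absv_diff_le[of x "x - y"] absv_add_le[of "x - y" y] by auto

lemma powi_pos [simp]: "real q powi n > 0"
  using q_pos by simp

lemma powi_less_iff: "real q powi m < real q powi n \<longleftrightarrow> m < n"
  using q_gt_1 by (metis linorder_neqE_linordered_idom order_less_asym order_less_irrefl power_int_strict_increasing)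

lemma powi_le_iff: "real q powi m \<le> real q powi n \<longleftrightarrow> m \<le> n"
  using powi_less_iff by (meson linorder_not_le)

text \<open>Integer powers of an element of absolute value \<open>q\<close> realize every radius.
  This allows a statement about all points of a ball to be rewritten as one about exponents.\<close>

lemma ex_absv_eq: "\<exists>x. absv x = real q powi n"
proof -
  obtain x where x: "absv x = real q" using ex_absv_eq_q by blast
  have x0: "x \<noteq> 0" using x q_pos by auto
  have nat: "absv (z ^ k) = absv z ^ k" for z k
    by (induction k) (auto simp: absv_mult)
  have "absv (inverse x) = inverse (absv x)"
    using absv_mult[of x "inverse x"] x0 by (simp add: field_simps)
  then have "absv (x powi n) = absv x powi n"
    by (simp add: power_int_def nat)
  then show ?thesis using x by metis
qed

section \<open>The topology induced by the absolute value\<close>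

interpretation metric: Metric_space UNIV "kdist absv"
proof
  fix x y z :: 'k
  show "kdist absv x y = kdist absv y x"
    by (simp add: kdist_def absv_minus_commute)
  show "kdist absv x z \<le> kdist absv x y + kdist absv y z"
    using absv_add_le[of "x - y" "y - z"] absv_nonneg[of "x - y"] absv_nonneg[of "y - z"]
    unfolding kdist_def by (simp del: absv_nonneg)
qed (auto simp: kdist_def)

lemma openin_ktop_iff:
  "openin (ktop absv) U \<longleftrightarrow> (\<forall>x\<in>U. \<exists>e>0. \<forall>y. absv (x - y) < e \<longrightarrow> y \<in> U)"
  unfolding ktop_def metric.openin_mtopology
  by (auto simp: metric.mball_def kdist_def subset_iff)

lemma topspace_ktop [simp]: "topspace (ktop absv) = UNIV"
  by (simp add: ktop_def)

lemma openin_ktop_less: "openin (ktop absv) {y. absv y < r}"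
  unfolding openin_ktop_iff
proof
  fix x assume "x \<in> {y. absv y < r}"
  then have x: "absv x < r" by simp
  show "\<exists>e>0. \<forall>y. absv (x - y) < e \<longrightarrow> y \<in> {y. absv y < r}"
  \<comment> \<open>Every point of an ultrametric ball is a center of it, so the radius
    \<open>r\<close> itself works.\<close>
  proof (intro exI[of _ r] conjI allI impI)
    show "r > 0" using x absv_nonneg[of x] by linarith
    fix y assume "absv (x - y) < r"
    then show "y \<in> {y. absv y < r}"
      using absv_diff_le[of x "x - y"] x by auto
  qed
qed

text \<open>No absolute value lies strictly between two consecutive powers of \<open>q\<close>.
  Closed balls are therefore open balls and inherit their measurability.\<close>

lemma absv_le_powi_iff: "absv y \<le> real q powi n \<longleftrightarrow> absv y < real q powi (n + 1)"
proof (cases y rule: absv_cases)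
  case 1
  then show ?thesis using powi_pos[of n] powi_pos[of "n + 1"] by (simp only: absv_0) (simp add: less_imp_le)
qed (auto simp: powi_le_iff powi_less_iff)

section \<open>Borel measurability of radial functions and the measure of balls\<close>

lemma sets_open: "openin (ktop absv) U \<Longrightarrow> U \<in> sets M"
  unfolding sets_M by blast

lemma sets_less [measurable]: "{y. absv y < r} \<in> sets M"
  using openin_ktop_less sets_open by blast

text \<open>The range is countable and the spheres are Borel, so every preimage is a countable union
  of Borel sets. The discrete target makes every function of the radius measurable, however
  irregular.\<close>

lemma measurable_absv: "absv \<in> measurable M (count_space UNIV)"
proof (rule measurableI)
  fix A :: "real set"
  let ?R = "insert 0 (range (\<lambda>n::int. real q powi n))"
  have R: "absv x \<in> ?R" for x
    by (cases x rule: absv_cases) auto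
  have sphere: "{y. absv y = r} \<in> sets M" for r
  proof -
    have "absv \<in> borel_measurable M"
      unfolding borel_measurable_iff_less using sets_less by simp
    then have "{y \<in> space M. absv y = r} \<in> sets M" by measurable
    then show ?thesis by simp
  qed
  have "absv -` A \<inter> space M = (\<Union>r\<in>A \<inter> ?R. {y. absv y = r})"
    using R by auto
  also have "\<dots> \<in> sets M"
  proof (rule sets.countable_UN'')
    have "countable ?R" by simp
    then show "countable (A \<inter> ?R)" by (rule countable_subset[rotated]) auto
  qed (rule sphere)
  finally show "absv -` A \<inter> space M \<in> sets M" .
qed simp

lemma radial_measurable [measurable]: "(\<lambda>y. h (absv y)) \<in> borel_measurable M"
  using measurable_compose[OF measurable_absv, of h borel] by simp

text \<open>Translation invariance and the residue field together give the scaling law: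
  multiplication by an element of absolute value \<open>q powi n\<close> carries the
  \<open>q\<close> residue classes onto disjoint translates of the open ball of that radius, and
  these fill the closed ball.\<close>

lemma emeasure_ball_step:
  "emeasure M {y. absv y \<le> real q powi n} = of_nat q * emeasure M {y. absv y < real q powi n}"
proof -
  obtain c where c: "absv c = real q powi n" using ex_absv_eq by blast
  have c0: "c \<noteq> 0" using c powi_pos[of n] absv_pos_iff[of c] by (simp del: powi_pos)
  let ?P = "valring absv // residue_rel absv"
  have fin: "finite ?P"
    using card_residue_field q_ge_2 by (intro card_ge_0_finite) simp
  have equiv: "equiv (valring absv) (residue_rel absv)"
  proof (intro equivI refl_onI symI transI)
    fix x y z assume "(x, y) \<in> residue_rel absv" "(y, z) \<in> residue_rel absv"
    then show "(x, z) \<in> residue_rel absv"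
      using absv_add_le[of "x - y" "y - z"] by (auto simp: residue_rel_def)
  qed (auto simp: residue_rel_def absv_minus_commute)
  have coset: "(\<lambda>t. c * t) ` X \<in> sets M \<and>
      emeasure M ((\<lambda>t. c * t) ` X) = emeasure M {y. absv y < real q powi n}" if X: "X \<in> ?P" for X
  proof -
    obtain t where t: "t \<in> valring absv" "X = residue_rel absv `` {t}"
      using X by (auto elim: quotientE)
    \<comment> \<open>A point at distance below 1 from \<open>t\<close> lies in the valuation ring
      automatically, so a residue class is a full open ball.\<close>
    have X_eq: "X = {y. absv (t - y) < 1}"
    proof -
      have "absv y \<le> 1" if "absv (t - y) < 1" for y
        using absv_diff_le[of t "t - y"] that t(1) by (auto simp: valring_def)
      then show ?thesis using t by (auto simp: residue_rel_def valring_def)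
    qed
    have scale: "absv (c * t - c * y) < real q powi n \<longleftrightarrow> absv (t - y) < 1" for y
      using absv_mult[of c "t - y"] c powi_pos[of n] by (simp add: right_diff_distrib)
    have "(\<lambda>t. c * t) ` X = {z. absv (c * t - z) < real q powi n}"
    proof (intro subset_antisym subsetI)
      fix z assume "z \<in> {z. absv (c * t - z) < real q powi n}"
      then show "z \<in> (\<lambda>t. c * t) ` X"
        using scale[of "z / c"] c0 X_eq by (intro image_eqI[of _ _ "z / c"]) auto
    qed (use scale X_eq in auto)
    also have "\<dots> = (\<lambda>y. c * t + y) ` {y. absv y < real q powi n}"
    proof (intro subset_antisym subsetI)
      fix z assume "z \<in> {z. absv (c * t - z) < real q powi n}"
      then show "z \<in> (\<lambda>y. c * t + y) ` {y. absv y < real q powi n}"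
        by (intro image_eqI[of _ _ "z - c * t"]) (auto simp: absv_minus_commute)
    qed auto
    finally have eq: "(\<lambda>t. c * t) ` X = (\<lambda>y. c * t + y) ` {y. absv y < real q powi n}" .
    have "openin (ktop absv) {z. absv (c * t - z) < real q powi n}"
      using metric.openin_mball[of "c * t" "real q powi n"]
      by (simp add: ktop_def metric.mball_def kdist_def)
    then have "(\<lambda>t. c * t) ` X \<in> sets M"
      using sets_open \<open>(\<lambda>t. c * t) ` X = {z. absv (c * t - z) < real q powi n}\<close> by simp
    then show ?thesis
      using emeasure_translate[OF sets_less, of "c * t" "real q powi n"] eq by simp
  qed
  have un: "{y. absv y \<le> real q powi n} = (\<Union>X\<in>?P. (\<lambda>t. c * t) ` X)"
  proof -
    have "(\<Union>X\<in>?P. (\<lambda>t. c * t) ` X) = (\<lambda>t. c * t) ` valring absv"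
      using Union_quotient[OF equiv] by blast
    also have "\<dots> = {y. absv y \<le> real q powi n}"
    proof (intro subset_antisym subsetI)
      fix z assume z: "z \<in> {y. absv y \<le> real q powi n}"
      have "absv c * absv (z / c) = absv z"
        using absv_mult[of c "z / c"] c0 by simp
      then have "absv (z / c) \<le> 1" using z c powi_pos[of n]
        by (metis mem_Collect_eq mult.right_neutral mult_le_cancel_left_pos)
      then show "z \<in> (\<lambda>t. c * t) ` valring absv"
        using c0 by (intro image_eqI[of _ _ "z / c"]) (auto simp: valring_def)
    qed (use c powi_pos[of n] in \<open>auto simp: valring_def absv_mult mult_le_cancel_left1\<close>)
    finally show ?thesis by simp
  qed
  have "disjoint_family_on (\<lambda>X. (\<lambda>t. c * t) ` X) ?P"
    unfolding disjoint_family_on_def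
  proof (intro ballI impI)
    fix X Y assume "X \<in> ?P" "Y \<in> ?P" "X \<noteq> Y"
    then have "X \<inter> Y = {}" using quotient_disj[OF equiv] by blast
    then show "(\<lambda>t. c * t) ` X \<inter> (\<lambda>t. c * t) ` Y = {}" using c0 by auto
  qed
  then have "emeasure M {y. absv y \<le> real q powi n} = (\<Sum>X\<in>?P. emeasure M ((\<lambda>t. c * t) ` X))"
    unfolding un using coset fin by (intro sum_emeasure[symmetric]) auto
  also have "\<dots> = of_nat q * emeasure M {y. absv y < real q powi n}"
    using coset card_residue_field by simp
  finally show ?thesis .
qed

text \<open>The open ball of radius \<open>q powi (n + 1)\<close> is the closed ball of radius
  \<open>q powi n\<close>, so each step multiplies the measure by \<open>q\<close>. The two-sided
  induction starts from the normalized unit ball.\<close>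

lemma emeasure_ball: "emeasure M {y. absv y \<le> real q powi n} = ennreal (real q powi n)"
proof -
  let ?e = "\<lambda>n. emeasure M {y. absv y \<le> real q powi n}"
  have step: "?e (n + 1) = of_nat q * ?e n" for n
    using emeasure_ball_step[of "n + 1"] by (simp add: absv_le_powi_iff)
  have powi: "real q powi (n + 1) = real q * real q powi n" for n
    using q_pos by (simp add: power_int_add)
  show ?thesis
  proof (induction n rule: int_induct[of _ 0])
    case base
    show ?case using emeasure_valring by (simp add: valring_def)
  next
    case (step1 i)
    then show ?case
      unfolding step by (simp add: powi ennreal_mult'' ennreal_of_nat_eq_real_of_nat)
  next
    case (step2 i)
    have "ennreal (real q) * ?e (i - 1) = ennreal (real q) * ennreal (real q powi (i - 1))"
      using step[of "i - 1"] powi[of "i - 1"] step2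
      by (simp add: ennreal_mult'' ennreal_of_nat_eq_real_of_nat)
    then show ?case
      using q_pos by (simp add: ennreal_mult_cancel_left)
  qed
qed

text \<open>The origin lies in balls of arbitrarily small measure. Integrands thus need estimates at
  positive radii only.\<close>

lemma AE_nonzero: "AE y in M. y \<noteq> 0"
proof -
  have sets0: "{0} \<in> sets M"
    using measurable_sets[OF measurable_absv, of "{0}"] by (simp add: vimage_def)
  have "emeasure M {0} \<le> ennreal e" if e: "e > 0" for e
  proof -
    obtain k where k: "inverse (real q) ^ k < e"
      using real_arch_pow_inv[OF e, of "inverse (real q)"] q_gt_1 by (auto simp: field_simps)
    have "emeasure M {0} \<le> emeasure M {y. absv y \<le> real q powi (- int k)}"
      by (intro emeasure_mono) (auto simp: absv_le_powi_iff less_imp_le)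
    also have "\<dots> \<le> ennreal e"
      unfolding emeasure_ball using k by (intro ennreal_leI) (simp add: power_int_minus power_inverse)
    finally show ?thesis .
  qed
  then have "emeasure M {0} \<le> 0"
    by (intro ennreal_le_epsilon[where y = 0]) simp
  then show ?thesis
    using sets0 by (intro AE_I[of _ _ "{0}"]) auto
qed

section \<open>Integrals of powers of the absolute value over balls\<close>

lemma powi_powr: "(real q powi k) powr b = real q powr (of_int k * b)"
  using q_pos by (simp add: powr_powr flip: powr_real_of_int')

text \<open>The integrand is constant on each sphere. Enlarging the sphere of radius
  \<open>q powi (n - 1 - j)\<close> to the whole ball of that radius leaves a geometric series of
  ratio \<open>q powr - b\<close>, which converges for every positive \<open>b\<close> even if the
  integrand is unbounded near 0.\<close>

lemma nn_integral_absv_powr_le: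
  assumes "b > 0"
  shows "(\<integral>\<^sup>+y. ennreal (absv y powr (b - 1)) * indicator {y. absv y < real q powi n} y \<partial>M)
           \<le> ennreal ((real q powi n) powr b / (1 - real q powr - b))"
proof -
  let ?r = "\<lambda>j::nat. real q powi (n - 1 - int j)"
  let ?z = "real q powr - b"
  have z: "0 < ?z" "?z < 1"
    using assms q_gt_1 by (auto simp: powr_less_one)
  have "ennreal (absv y powr (b - 1)) * indicator {y. absv y < real q powi n} y
      \<le> (\<Sum>j. ennreal (?r j powr (b - 1)) * indicator {y. absv y \<le> ?r j} y)" for y
  proof (cases y rule: absv_cases)
    case (2 k)
    let ?f = "\<lambda>j. ennreal (?r j powr (b - 1)) * indicator {y. absv y \<le> ?r j} y"
    show ?thesis
    proof (cases "k < n")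
      case True
      \<comment> \<open>This index picks the ball of radius exactly |y|; its summand alone already
        equals the integrand.\<close>
      define j where "j = nat (n - 1 - k)"
      have "n - 1 - int j = k" using True by (simp add: j_def)
      then have "ennreal (absv y powr (b - 1)) * indicator {y. absv y < real q powi n} y \<le> ?f j"
        using 2 by (auto simp: indicator_def)
      also have "?f j = sum ?f {j}"
        by (simp only: sum.insert[of "{}"] sum.empty finite.emptyI empty_iff not_False_eq_True add_0_right)
      also have "\<dots> \<le> (\<Sum>j. ?f j)"
        by (rule sum_le_suminf) auto
      finally show ?thesis .
    qed (use 2 in \<open>simp add: powi_less_iff\<close>)
  \<comment> \<open>At y = 0 the left side vanishes, because
    \<open>0 powr (b - 1) = 0\<close>.\<close>
  qed simp
  then have "(\<integral>\<^sup>+y. ennreal (absv y powr (b - 1)) * indicator {y. absv y < real q powi n} y \<partial>M)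
      \<le> (\<integral>\<^sup>+y. (\<Sum>j. ennreal (?r j powr (b - 1)) * indicator {y. absv y \<le> ?r j} y) \<partial>M)"
    by (intro nn_integral_mono) simp
  also have "\<dots> = (\<Sum>j. \<integral>\<^sup>+y. ennreal (?r j powr (b - 1)) * indicator {y. absv y \<le> ?r j} y \<partial>M)"
    by (intro nn_integral_suminf) (simp add: absv_le_powi_iff)
  also have "\<dots> = (\<Sum>j. ennreal ((real q powi n) powr b * ?z * ?z ^ j))"
  proof (intro suminf_cong)
    fix j
    have meas: "{y. absv y \<le> ?r j} \<in> sets M"
      by (simp add: absv_le_powi_iff)
    have pow: "?r j powr (b - 1) * ?r j = (real q powi n) powr b * ?z * ?z ^ j"
    proof -
      have "?r j powr (b - 1) * ?r j = ?r j powr (b - 1) * ?r j powr 1"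
        using powi_pos[of "n - 1 - int j"] by simp
      also have "\<dots> = ?r j powr b"
        unfolding powr_add[symmetric] by simp
      also have "\<dots> = real q powr (of_int n * b + - b + real j * - b)"
        unfolding powi_powr by (simp add: algebra_simps)
      also have "\<dots> = (real q powi n) powr b * ?z * ?z ^ j"
        unfolding powi_powr powr_add using q_pos
        by (simp add: powr_power mult.commute)
      finally show ?thesis .
    qed
    show "(\<integral>\<^sup>+y. ennreal (?r j powr (b - 1)) * indicator {y. absv y \<le> ?r j} y \<partial>M)
        = ennreal ((real q powi n) powr b * ?z * ?z ^ j)"
      unfolding nn_integral_cmult_indicator[OF meas] emeasure_ball pow[symmetric]
      by (simp add: ennreal_mult'' less_imp_le)
  qed
  also have "\<dots> = ennreal ((real q powi n) powr b * ?z * (1 / (1 - ?z)))"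
    using z by (intro suminf_ennreal_eq sums_mult geometric_sums) (auto simp: less_imp_le)
  also have "\<dots> \<le> ennreal ((real q powi n) powr b / (1 - ?z))"
    using z by (intro ennreal_leI) (auto simp: divide_simps mult_left_le)
  finally show ?thesis .
qed

section \<open>Volterra operators on radial functions\<close>

text \<open>The integral term written in radii alone and for an arbitrary kernel: existence and
  uniqueness below use only a bound of the form \<open>A * s powr (b - 1)\<close> on it.\<close>

definition volterra :: "(real \<Rightarrow> real \<Rightarrow> complex) \<Rightarrow> (real \<Rightarrow> complex) \<Rightarrow> real \<Rightarrow> complex" where
  "volterra \<kappa> v r = (LINT y:{y. absv y < r}|M. \<kappa> r (absv y) * v (absv y))"

text \<open>Off the null set of the origin the integrand is at most \<open>A * B\<close> times a
  power of |y| whose integral is controlled. That \<open>v\<close> has to be bounded only at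
  exponents below \<open>n\<close> is what permits induction over radii.\<close>

lemma volterra_bound:
  fixes \<kappa> :: "real \<Rightarrow> real \<Rightarrow> complex"
  assumes b: "b > 0" and "A \<ge> 0" "B \<ge> 0"
    and \<kappa>: "\<And>s. 0 < s \<Longrightarrow> s < real q powi n \<Longrightarrow> cmod (\<kappa> (real q powi n) s) \<le> A * s powr (b - 1)"
    and v: "\<And>k. k < n \<Longrightarrow> cmod (v (real q powi k)) \<le> B"
  shows volterra_set_integrable:
      "set_integrable M {y. absv y < real q powi n} (\<lambda>y. \<kappa> (real q powi n) (absv y) * v (absv y))"
    and norm_volterra_le:
      "cmod (volterra \<kappa> v (real q powi n)) \<le> A * ((real q powi n) powr b / (1 - real q powr - b)) * B"
proof -
  let ?r = "real q powi n" and ?C = "(real q powi n) powr b / (1 - real q powr - b)"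
  let ?f = "\<lambda>y. indicator {y. absv y < ?r} y *\<^sub>R (\<kappa> ?r (absv y) * v (absv y))"
  have C: "?C \<ge> 0"
    using b q_gt_1 by (simp add: powr_less_one less_imp_le)
  have "(\<integral>\<^sup>+y. ennreal (norm (?f y)) \<partial>M)
      \<le> (\<integral>\<^sup>+y. ennreal (A * B) * (ennreal (absv y powr (b - 1)) * indicator {y. absv y < ?r} y) \<partial>M)"
  proof (intro nn_integral_mono_AE, use AE_nonzero in eventually_elim)
    fix y :: 'k assume y: "y \<noteq> 0"
    show "ennreal (norm (?f y))
        \<le> ennreal (A * B) * (ennreal (absv y powr (b - 1)) * indicator {y. absv y < ?r} y)"
    proof (cases "absv y < ?r")
      case True
      obtain k where k: "absv y = real q powi k" using y by (cases y rule: absv_cases) auto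
      have "k < n" using True k powi_less_iff by simp
      then have "norm (?f y) \<le> (A * absv y powr (b - 1)) * B"
        using True y v[of k] k \<kappa>[of "absv y"] assms(2)
        by (auto simp: norm_mult intro!: mult_mono)
      then show ?thesis
        using True assms(2,3) by (auto simp: mult_ac simp flip: ennreal_mult' intro!: ennreal_leI)
    qed simp
  qed
  also have "\<dots> = ennreal (A * B) *
      (\<integral>\<^sup>+y. ennreal (absv y powr (b - 1)) * indicator {y. absv y < ?r} y \<partial>M)"
    by (intro nn_integral_cmult) measurable
  also have "\<dots> \<le> ennreal (A * B) * ennreal ?C"
    by (intro mult_left_mono nn_integral_absv_powr_le b) simp
  also have "\<dots> = ennreal (A * ?C * B)"
    using assms(2,3) C by (simp add: mult_ac flip: ennreal_mult')
  finally have le: "(\<integral>\<^sup>+y. ennreal (norm (?f y)) \<partial>M) \<le> ennreal (A * ?C * B)" .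
  have int: "integrable M ?f"
    using le by (intro integrableI_bounded) (auto simp: le_less_trans)
  then show "set_integrable M {y. absv y < ?r} (\<lambda>y. \<kappa> ?r (absv y) * v (absv y))"
    by (simp add: set_integrable_def)
  have "ennreal (norm (LINT y|M. ?f y)) \<le> ennreal (A * ?C * B)"
    using integral_norm_bound_ennreal[OF int] le by (rule order_trans)
  then show "cmod (volterra \<kappa> v ?r) \<le> A * ?C * B"
    using mult_nonneg_nonneg[OF mult_nonneg_nonneg[OF assms(2) C] assms(3)]
    unfolding volterra_def set_lebesgue_integral_def by (subst (asm) ennreal_le_iff)
qed

lemma volterra_cong:
  assumes "\<And>y. absv y < r \<Longrightarrow> v (absv y) = w (absv y)"
  shows "volterra \<kappa> v r = volterra \<kappa> w r"
  unfolding volterra_def by (intro set_lebesgue_integral_cong) (auto simp: assms)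

text \<open>Banach's fixed point theorem on bounded functions of the exponent, where
  \<open>contr\<close> makes the map a contraction with factor 1/2. With the discrete topology on
  the exponents, bounded continuous functions are all bounded functions, and they form a complete
  space.\<close>

lemma volterra_solution_small:
  fixes \<kappa> :: "real \<Rightarrow> real \<Rightarrow> complex"
  assumes b: "b > 0"
    and A: "\<And>k. A k \<ge> 0"
    and \<kappa>: "\<And>k s. k \<le> n \<Longrightarrow> 0 < s \<Longrightarrow> s < real q powi k \<Longrightarrow>
              cmod (\<kappa> (real q powi k) s) \<le> A k * s powr (b - 1)"
    and contr: "\<And>k. k \<le> n \<Longrightarrow> A k * ((real q powi k) powr b / (1 - real q powr - b)) \<le> 1 / 2"
    and G: "\<And>k. k \<le> n \<Longrightarrow> cmod (G (real q powi k)) \<le> B"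
  shows "\<exists>v C. v 0 = G 0 \<and> (\<forall>k. cmod (v (real q powi k)) \<le> C) \<and>
           (\<forall>k\<le>n. v (real q powi k) + volterra \<kappa> v (real q powi k) = G (real q powi k))"
proof -
  let ?Q = "\<lambda>k::int. real q powi k"
  \<comment> \<open>A function of the exponent becomes one of the radius; the logarithm recovers
    \<open>k\<close> from \<open>q powi k\<close>. The value at 0 is the one that the integral
    equation dictates at x = 0, where the domain of integration is empty.\<close>
  define ext :: "(int discrete \<Rightarrow>\<^sub>C complex) \<Rightarrow> real \<Rightarrow> complex"
    where "ext u s = (if s = 0 then G 0 else apply_bcontfun u (discrete \<lfloor>log (real q) s\<rfloor>))" for u s
  have ext: "ext u (?Q k) = apply_bcontfun u (discrete k)" for u k
  proof -
    have "log (real q) (?Q k) = of_int k"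
      using q_gt_1 by (simp flip: powr_real_of_int')
    then show ?thesis using powi_pos[of k] by (simp add: ext_def)
  qed
  define T0 where "T0 u k = (if of_discrete k \<le> n
      then G (?Q (of_discrete k)) - volterra \<kappa> (ext u) (?Q (of_discrete k)) else 0)" for u k
  have bound: "cmod (volterra \<kappa> (ext u) (?Q k)) \<le> 1 / 2 * norm u" if "k \<le> n" for u k
  proof -
    have "cmod (volterra \<kappa> (ext u) (?Q k)) \<le> A k * (?Q k powr b / (1 - real q powr - b)) * norm u"
      using that by (intro norm_volterra_le b A \<kappa>) (auto simp: ext norm_bounded)
    also have "\<dots> \<le> 1 / 2 * norm u"
      using contr[OF that] by (rule mult_right_mono) simp
    finally show ?thesis .
  qed
  define T where "T u = Bcontfun (T0 u)" for u
  have T: "apply_bcontfun (T u) = T0 u" for u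
    unfolding T_def
  proof (intro Bcontfun_inverse bcontfun_normI)
    show "norm (T0 u k) \<le> \<bar>B\<bar> + 1 / 2 * norm u" for k
      using bound[of "of_discrete k" u] G[of "of_discrete k"]
        norm_triangle_ineq4[of "G (?Q (of_discrete k))" "volterra \<kappa> (ext u) (?Q (of_discrete k))"]
      by (auto simp: T0_def)
    \<comment> \<open>Distance below 1 in the discrete space means equality, so every map is
      continuous.\<close>
    show "continuous_on UNIV (T0 u)"
      by (auto intro!: continuous_onI exI[of _ 1] simp: dist_discrete_def split: if_splits)
  qed
  have "\<exists>!u. T u = u"
  proof (rule banach_fix_type[of "1 / 2"])
    show "\<forall>u w. dist (T u) (T w) \<le> 1 / 2 * dist u w"
    proof (intro allI dist_bound)
      fix u w and k' :: "int discrete"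
      define k where "k = of_discrete k'"
      have k': "k' = discrete k" by (simp add: k_def of_discrete_inverse)
      show "dist (apply_bcontfun (T u) k') (apply_bcontfun (T w) k') \<le> 1 / 2 * dist u w"
      proof (cases "k \<le> n")
        case True
        let ?d = "\<lambda>s. ext u s - ext w s"
        have int: "set_integrable M {y. absv y < ?Q k} (\<lambda>y. \<kappa> (?Q k) (absv y) * ext u (absv y))" for u
          using True by (intro volterra_set_integrable[OF b, of "A k" "norm u"] A \<kappa>)
            (auto simp: ext norm_bounded)
        \<comment> \<open>Integrability of both terms allows the use of linearity, and the Lipschitz
          estimate becomes the norm bound for the difference.\<close>
        have "volterra \<kappa> (ext u) (?Q k) - volterra \<kappa> (ext w) (?Q k) = volterra \<kappa> ?d (?Q k)"
          unfolding volterra_def using int by (simp add: right_diff_distrib)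
        moreover have "cmod (volterra \<kappa> ?d (?Q k))
            \<le> A k * (?Q k powr b / (1 - real q powr - b)) * dist u w"
          using True by (intro norm_volterra_le b A \<kappa>)
            (auto simp: ext dist_bounded simp flip: dist_norm)
        moreover have "\<dots> \<le> 1 / 2 * dist u w"
          using contr[OF True] by (rule mult_right_mono) simp
        ultimately have "cmod (volterra \<kappa> (ext u) (?Q k) - volterra \<kappa> (ext w) (?Q k)) \<le> 1 / 2 * dist u w"
          by (simp only: order_trans)
        then show ?thesis
          using True by (simp add: T T0_def k' discrete_inverse dist_norm norm_minus_commute)
      qed (simp add: T T0_def k' discrete_inverse)
    qed
  qed auto
  then obtain u where u: "T u = u" by blast
  have "ext u (?Q k) + volterra \<kappa> (ext u) (?Q k) = G (?Q k)" if "k \<le> n" for k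
    using T[of u] that by (simp add: u ext T0_def discrete_inverse)
  moreover have "cmod (ext u (?Q k)) \<le> norm u" for k
    by (simp add: ext norm_bounded)
  moreover have "ext u 0 = G 0" by (simp add: ext_def)
  ultimately show ?thesis by blast
qed

text \<open>The equation at radius \<open>q\<^bsup>m+1\<^esup>\<close> expresses the value there through the values at smaller
  radii, so no contraction is needed to pass to larger balls.\<close>

lemma volterra_solution_extend:
  fixes \<kappa> :: "real \<Rightarrow> real \<Rightarrow> complex"
  assumes "\<exists>v C. v 0 = G 0 \<and> (\<forall>k. cmod (v (real q powi k)) \<le> C) \<and>
             (\<forall>k\<le>n. v (real q powi k) + volterra \<kappa> v (real q powi k) = G (real q powi k))"
    and "n \<le> m"
  shows "\<exists>v C. v 0 = G 0 \<and> (\<forall>k. cmod (v (real q powi k)) \<le> C) \<and>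
           (\<forall>k\<le>m. v (real q powi k) + volterra \<kappa> v (real q powi k) = G (real q powi k))"
  using assms(2)
proof (induction m rule: int_ge_induct)
  case base
  then show ?case by (rule assms)
next
  case (step m)
  let ?Q = "\<lambda>k::int. real q powi k"
  obtain v C where v: "v 0 = G 0" "\<And>k. cmod (v (?Q k)) \<le> C"
      "\<And>k. k \<le> m \<Longrightarrow> v (?Q k) + volterra \<kappa> v (?Q k) = G (?Q k)"
    using step.IH by blast
  define x where "x = G (?Q (m + 1)) - volterra \<kappa> v (?Q (m + 1))"
  define w where "w = v(?Q (m + 1) := x)"
  have w_eq: "w (?Q k) = (if k = m + 1 then x else v (?Q k))" for k
    using powi_less_iff[of k "m + 1"] powi_less_iff[of "m + 1" k] by (auto simp: w_def)
  \<comment> \<open>The altered value sits on the sphere of radius \<open>q powi (m + 1)\<close>,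
    outside the open ball of integration even for \<open>k = m + 1\<close>. So the old equations
    survive and the new one holds by the choice of \<open>x\<close>.\<close>
  have vol: "volterra \<kappa> w (?Q k) = volterra \<kappa> v (?Q k)" if "k \<le> m + 1" for k
    using that powi_le_iff[of k "m + 1"] by (intro volterra_cong) (auto simp: w_def)
  have "w (?Q k) + volterra \<kappa> w (?Q k) = G (?Q k)" if "k \<le> m + 1" for k
    using that v(3)[of k] by (auto simp: vol w_eq x_def)
  moreover have "w 0 = G 0"
    using v(1) powi_pos[of "m + 1"] by (auto simp: w_def simp del: powi_pos)
  moreover have "cmod (w (?Q k)) \<le> max C (cmod x)" for k
    using v(2)[of k] by (auto simp: w_eq)
  ultimately show ?case by blast
qed

lemma volterra_homogeneous_unique:
  fixes \<kappa> :: "real \<Rightarrow> real \<Rightarrow> complex"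
  assumes b: "b > 0"
    and A: "\<And>k. A k \<ge> 0"
    and \<kappa>: "\<And>k s. 0 < s \<Longrightarrow> s < real q powi k \<Longrightarrow>
              cmod (\<kappa> (real q powi k) s) \<le> A k * s powr (b - 1)"
    and contr: "\<And>k. k \<le> n \<Longrightarrow> A k * ((real q powi k) powr b / (1 - real q powr - b)) \<le> 1 / 2"
    and bounded: "\<And>k. k \<le> n \<Longrightarrow> cmod (d (real q powi k)) \<le> B"
    and eq: "\<And>k. k \<le> m \<Longrightarrow> d (real q powi k) + volterra \<kappa> d (real q powi k) = 0"
    and "n \<le> m"
  shows "k \<le> m \<Longrightarrow> d (real q powi k) = 0"
proof -
  let ?Q = "\<lambda>k::int. real q powi k"
  \<comment> \<open>One use of the equation: a bound \<open>D\<close> at all strictly smaller radii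
    gives a bound at \<open>k\<close>. It serves with \<open>D = B * (1 / 2) ^ j\<close> up to
    \<open>n\<close> and with \<open>D = 0\<close> beyond.\<close>
  have d: "cmod (d (?Q k)) \<le> A k * (?Q k powr b / (1 - real q powr - b)) * D"
    if "k \<le> m" "D \<ge> 0" "\<And>l. l < k \<Longrightarrow> cmod (d (?Q l)) \<le> D" for k D
  proof -
    have "d (?Q k) = - volterra \<kappa> d (?Q k)"
      using eq[OF that(1)] by (simp add: eq_neg_iff_add_eq_0)
    then show ?thesis
      using norm_volterra_le[of b "A k" D k \<kappa> d] b A \<kappa> that(2,3) by simp
  qed
  have B: "B \<ge> 0" using bounded[of n] norm_ge_zero order_trans by blast
  have half: "cmod (d (?Q k)) \<le> B * (1 / 2) ^ j" if "k \<le> n" for k j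
    using that
  proof (induction j arbitrary: k)
    case (Suc j)
    have "cmod (d (?Q k)) \<le> A k * (?Q k powr b / (1 - real q powr - b)) * (B * (1 / 2) ^ j)"
      using Suc B \<open>n \<le> m\<close> by (intro d) auto
    also have "\<dots> \<le> 1 / 2 * (B * (1 / 2) ^ j)"
      using B by (intro mult_right_mono contr Suc.prems) simp
    finally show ?case by simp
  qed (use bounded in simp)
  have small: "d (?Q k) = 0" if "k \<le> n" for k
  proof -
    have "(\<lambda>j. B * (1 / 2) ^ j) \<longlonglongrightarrow> B * 0"
      by (intro tendsto_mult_left LIMSEQ_power_zero) simp
    then have "cmod (d (?Q k)) \<le> B * 0"
      using half[OF that] by (intro LIMSEQ_le_const) auto
    then show ?thesis by simp
  qed
  have "\<forall>k\<le>l. k \<le> m \<longrightarrow> d (?Q k) = 0" if "n \<le> l" for l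
    using that
  proof (induction l rule: int_ge_induct)
    case (step l)
    show ?case
    proof (intro allI impI)
      fix k assume k: "k \<le> l + 1" "k \<le> m"
      have "cmod (d (?Q k)) \<le> A k * (?Q k powr b / (1 - real q powr - b)) * 0"
        using k step by (intro d) auto
      then show "d (?Q k) = 0" by simp
    qed
  qed (simp add: small)
  then show "k \<le> m \<Longrightarrow> d (?Q k) = 0"
    using \<open>n \<le> m\<close> by blast
qed

section \<open>Radii tending to 0 and continuity of radial functions\<close>

lemma powi_tendsto_0: "((\<lambda>k::int. real q powi k) \<longlongrightarrow> 0) at_bot"
proof (rule tendstoI)
  fix e :: real assume e: "e > 0"
  obtain j where j: "inverse (real q) ^ j < e"
    using real_arch_pow_inv[OF e, of "inverse (real q)"] q_gt_1 by (auto simp: field_simps)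
  have "dist (real q powi k) 0 < e" if "k \<le> - int j" for k
  proof -
    have "real q powi k \<le> real q powi (- int j)" using that by (simp add: powi_le_iff)
    also have "\<dots> < e" using j by (simp add: power_int_minus power_inverse)
    finally show ?thesis using powi_pos[of k] by (simp del: powi_pos)
  qed
  then show "\<forall>\<^sub>F k in at_bot. dist (real q powi k) 0 < e"
    unfolding eventually_at_bot_linorder by blast
qed

lemma powi_powr_tendsto_0:
  assumes "b > 0"
  shows "((\<lambda>k::int. (real q powi k) powr b) \<longlongrightarrow> 0) at_bot"
  using tendsto_zero_powrI[OF powi_tendsto_0 tendsto_const _ assms] by (simp add: less_imp_le)

text \<open>A radial function is locally constant away from \<open>0\<close>.\<close>

lemma radial_continuous_iff:
  "continuous_map (subtopology (ktop absv) (ball_N absv q N)) euclidean (\<lambda>x. v (absv x))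
     \<longleftrightarrow> ((\<lambda>k. v (real q powi k)) \<longlongrightarrow> v 0) at_bot"
  for v :: "real \<Rightarrow> complex"
proof
  let ?B = "ball_N absv q N"
  have B_open: "openin (ktop absv) ?B"
    using openin_ktop_less[of "real q powi (N + 1)"] by (simp add: ball_N_def absv_le_powi_iff)
  have B0: "0 \<in> ?B" by (simp add: ball_N_def less_imp_le)
  {
    assume cont: "continuous_map (subtopology (ktop absv) ?B) euclidean (\<lambda>x. v (absv x))"
    show "((\<lambda>k. v (real q powi k)) \<longlongrightarrow> v 0) at_bot"
    proof (rule topological_tendstoI)
      fix U assume U: "open U" "v 0 \<in> U"
      have "openin (subtopology (ktop absv) ?B) {x \<in> ?B. v (absv x) \<in> U}"
        using cont U by (auto simp: continuous_map_def)
      then have "openin (ktop absv) {x \<in> ?B. v (absv x) \<in> U}"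
        using B_open openin_trans_full by blast
      moreover have "0 \<in> {x \<in> ?B. v (absv x) \<in> U}" using B0 U by simp
      ultimately obtain e where e: "e > 0" "\<And>y. absv (0 - y) < e \<Longrightarrow> v (absv y) \<in> U"
        unfolding openin_ktop_iff by (metis (no_types, lifting) mem_Collect_eq)
      have "\<forall>\<^sub>F k in at_bot. real q powi k < e"
        by (rule order_tendstoD(2)[OF powi_tendsto_0 e(1)])
      then show "\<forall>\<^sub>F k in at_bot. v (real q powi k) \<in> U"
      proof eventually_elim
        case (elim k)
        obtain y where y: "absv y = real q powi k" using ex_absv_eq by blast
        then show ?case using e(2)[of y] elim by simp
      qed
    qed
  }
  assume lim: "((\<lambda>k. v (real q powi k)) \<longlongrightarrow> v 0) at_bot"
  have "openin (ktop absv) {x \<in> ?B. v (absv x) \<in> U}" if U: "open U" for U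
    unfolding openin_ktop_iff
  proof
    fix x assume "x \<in> {x \<in> ?B. v (absv x) \<in> U}"
    then have x: "x \<in> ?B" "v (absv x) \<in> U" by auto
    show "\<exists>e>0. \<forall>y. absv (x - y) < e \<longrightarrow> y \<in> {x \<in> ?B. v (absv x) \<in> U}"
    proof (cases "x = 0")
      case False
      have "y \<in> {x \<in> ?B. v (absv x) \<in> U}" if "absv (x - y) < absv x" for y
        using x absv_eq_of_close[OF that] by (simp add: ball_N_def)
      then show ?thesis
        using False by (intro exI[of _ "absv x"]) simp
    next
      case True
      have "\<forall>\<^sub>F k in at_bot. v (real q powi k) \<in> U"
        using lim U x True by (auto simp: tendsto_def)
      then obtain n where n: "\<And>k. k \<le> n \<Longrightarrow> v (real q powi k) \<in> U"
        unfolding eventually_at_bot_linorder by blast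
      \<comment> \<open>The minimum keeps \<open>y\<close> inside the ball and at a radius where the
        value of \<open>v\<close> lies in \<open>U\<close>.\<close>
      have "y \<in> {x \<in> ?B. v (absv x) \<in> U}" if y: "absv y < real q powi min n N" for y
      proof (cases y rule: absv_cases)
        case 1
        then show ?thesis using x True by simp
      next
        case (2 k)
        then have "k < min n N" using y powi_less_iff by simp
        then show ?thesis using n[of k] 2 by (auto simp: ball_N_def powi_le_iff)
      qed
      then show ?thesis
        using True by (intro exI[of _ "real q powi min n N"]) simp
    qed
  qed
  then show "continuous_map (subtopology (ktop absv) ?B) euclidean (\<lambda>x. v (absv x))"
    using B_open by (auto simp: continuous_map_def openin_open_subtopology)
qed

end

section \<open>Estimate of the kernel\<close>

text \<open>The weight \<open>r powr (\<alpha> - b) * s powr (b - 1)\<close> dominates both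
  \<open>r powr (\<alpha> - 1)\<close> and \<open>s powr (\<alpha> - 1)\<close>, because s < r, b <
  1 and b \<le> \<alpha>; in the case \<alpha> = 1 it dominates the logarithm of r / s up to a
  factor 2.\<close>

lemma norm_kern_le:
  fixes r s \<alpha> b :: real
  assumes "\<alpha> > 0" and s: "0 < s" "s < r" and b: "0 < b" "b \<le> \<alpha>" "b \<le> 1 / 2"
  shows "cmod (kern (\<lambda>r. r) q \<alpha> a r s)
    \<le> 2 * (\<bar>c_alpha q \<alpha>\<bar> + \<bar>(1 - real q) / (real q * ln (real q))\<bar>)
       * cmod (inverse (1 + of_real (real q powr - \<alpha>) * a r * of_real (r powr \<alpha>)))
       * cmod (a r) * r powr (\<alpha> - b) * s powr (b - 1)"
    (is "_ \<le> 2 * (?c + ?l) * ?i * cmod (a r) * _ * _")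
proof -
  let ?p = "r powr (\<alpha> - b) * s powr (b - 1)"
  let ?I = "inverse (1 + of_real (real q powr - \<alpha>) * a r * of_real (r powr \<alpha>)) :: complex"
  \<comment> \<open>Both branches are a real constant times the inverse bracket, \<open>a r\<close>
    and a real difference \<open>t\<close>. Adding the absolute values of the two constants gives
    one bound for both.\<close>
  have "\<exists>c t. kern (\<lambda>r. r) q \<alpha> a r s = of_real c * ?I * a r * of_real t
      \<and> \<bar>c\<bar> \<le> ?c + ?l \<and> \<bar>t\<bar> \<le> 2 * ?p"
  proof (cases "\<alpha> = 1")
    case False
    have "r powr (\<alpha> - 1) = r powr (\<alpha> - b) * r powr (b - 1)"
      by (simp flip: powr_add)
    also have "\<dots> \<le> ?p"
      using s b by (intro mult_left_mono powr_mono2') auto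
    finally have 1: "r powr (\<alpha> - 1) \<le> ?p" .
    have "s powr (\<alpha> - 1) = s powr (\<alpha> - b) * s powr (b - 1)"
      by (simp flip: powr_add)
    also have "\<dots> \<le> ?p"
      using s b by (intro mult_right_mono powr_mono2) auto
    finally have 2: "s powr (\<alpha> - 1) \<le> ?p" .
    have "\<bar>r powr (\<alpha> - 1) - s powr (\<alpha> - 1)\<bar> \<le> 2 * ?p"
      using 1 2 powr_ge_zero[of r "\<alpha> - 1"] powr_ge_zero[of s "\<alpha> - 1"] by linarith
    then show ?thesis
      using False s
      by (intro exI[of _ "c_alpha q \<alpha>"] exI[of _ "r powr (\<alpha> - 1) - s powr (\<alpha> - 1)"])
        (auto simp: kern_def mult_ac)
  next
    case True
    have "\<bar>ln r - ln s\<bar> = ln (r / s)"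
      using s by (simp add: ln_div)
    \<comment> \<open>The exponent 1 - b equals \<alpha> - b here and reproduces the weight; b \<le>
      1/2 keeps the constant at most 2.\<close>
    also have "\<dots> \<le> (r / s) powr (1 - b) / (1 - b)"
      using s b by (intro ln_powr_bound) auto
    also have "\<dots> \<le> (r / s) powr (1 - b) * 2"
      using b mult_left_mono[of "1 / (1 - b)" 2 "(r / s) powr (1 - b)"] by (simp add: divide_simps)
    also have "(r / s) powr (1 - b) = ?p"
    proof -
      have "s powr (b - 1) = inverse (s powr (1 - b))"
        by (simp flip: powr_minus)
      then show ?thesis using True s by (simp add: powr_divide) (simp add: divide_inverse)
    qed
    finally have "\<bar>ln r - ln s\<bar> \<le> 2 * ?p" by simp
    then show ?thesis
      using True s
      by (intro exI[of _ "(1 - real q) / (real q * ln (real q))"] exI[of _ "ln r - ln s"])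
        (auto simp: kern_def powr_minus)
  qed
  then obtain c t where ct: "kern (\<lambda>r. r) q \<alpha> a r s = of_real c * ?I * a r * of_real t"
      "\<bar>c\<bar> \<le> ?c + ?l" "\<bar>t\<bar> \<le> 2 * ?p"
    by blast
  have "cmod (kern (\<lambda>r. r) q \<alpha> a r s) = \<bar>c\<bar> * ?i * cmod (a r) * \<bar>t\<bar>"
    unfolding ct(1) norm_mult norm_of_real ..
  also have "\<dots> \<le> (?c + ?l) * ?i * cmod (a r) * (2 * ?p)"
    using ct by (intro mult_mono) auto
  finally show ?thesis by (simp only: mult_ac)
qed

section \<open>Existence and uniqueness for the integral equation on the ball of radius
  \<open>q powi N\<close>\<close>

theorem theorem1:
  fixes absv :: "'k::field \<Rightarrow> real" and q :: nat and M :: "'k measure"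
    and \<alpha> :: real and a f :: "real \<Rightarrow> complex" and N :: int
  assumes K: "nonarch_local_field absv q M"
    and alpha_pos: "\<alpha> > 0"
    and a_cont: "continuous_map (ktop absv) euclidean (\<lambda>x. a (absv x))"
    and f_cont: "continuous_map (ktop absv) euclidean (\<lambda>x. f (absv x))"
    and small: "\<forall>x. absv x \<le> real q powi N \<longrightarrow>
                 cmod (of_real (real q powr (-\<alpha>)) * a (absv x) * of_real (absv x powr \<alpha>)) < 1"
  shows "(\<exists>v. is_solution absv q M \<alpha> a f N v) \<and>
         (\<forall>v w. is_solution absv q M \<alpha> a f N v \<and> is_solution absv q M \<alpha> a f N w \<longrightarrow>
                (\<forall>x \<in> ball_N absv q N. v (absv x) = w (absv x)))"
proof -
  interpret local_field absv q M by unfold_locales (rule K)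
  let ?Q = "\<lambda>k::int. real q powi k"
  \<comment> \<open>With the identity on the reals in place of \<open>absv\<close>,
    \<open>kern\<close> becomes a function of two radii.\<close>
  define \<kappa> where "\<kappa> = kern (\<lambda>r. r) q \<alpha> a"
  \<comment> \<open>Positivity of \<open>b\<close> gives integrability; the kernel estimate wants it
    at most \<alpha> and at most 1/2.\<close>
  define b where "b = min \<alpha> 1 / 2"
  have b: "0 < b" "b \<le> \<alpha>" "b \<le> 1 / 2" using alpha_pos by (auto simp: b_def)
  define G where "G = Fun absv q \<alpha> a f"
  define I where "I k = inverse (1 + of_real (real q powr - \<alpha>) * a (?Q k) * of_real (?Q k powr \<alpha>))" for k
  define c where "c = 2 * (\<bar>c_alpha q \<alpha>\<bar> + \<bar>(1 - real q) / (real q * ln (real q))\<bar>)"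
  define A where "A k = c * cmod (I k) * cmod (a (?Q k)) * ?Q k powr (\<alpha> - b)" for k
  define z where "z = 1 - real q powr - b"
  have A: "A k \<ge> 0" for k by (simp add: A_def c_def)
  have \<kappa>: "cmod (\<kappa> (?Q k) s) \<le> A k * s powr (b - 1)" if "0 < s" "s < ?Q k" for k s
    unfolding \<kappa>_def A_def I_def c_def using norm_kern_le[OF alpha_pos that b] .
  have a_lim: "((\<lambda>k. a (?Q k)) \<longlongrightarrow> a 0) at_bot" and f_lim: "((\<lambda>k. f (?Q k)) \<longlongrightarrow> f 0) at_bot"
    using continuous_map_from_subtopology[OF a_cont] continuous_map_from_subtopology[OF f_cont]
      radial_continuous_iff[of N] by blast+
  note pow_lim = powi_powr_tendsto_0[OF alpha_pos]
  have I_lim: "(I \<longlongrightarrow> 1) at_bot"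
  proof -
    have "(I \<longlongrightarrow> inverse (1 + of_real (real q powr - \<alpha>) * a 0 * of_real 0)) at_bot"
      unfolding I_def by (intro tendsto_intros a_lim pow_lim) simp
    then show ?thesis by simp
  qed
  have G_lim: "((\<lambda>k. G (?Q k)) \<longlongrightarrow> G 0) at_bot"
    using tendsto_mult[OF I_lim f_lim] by (simp add: G_def Fun_def I_def)
  \<comment> \<open>The exponents \<alpha> - b and b add up to \<alpha>, and the remaining factors
    converge, so the bound on the operator tends to 0 with the radius.\<close>
  have contr_lim: "((\<lambda>k. A k * (?Q k powr b / z)) \<longlongrightarrow> 0) at_bot"
  proof -
    have "A k * (?Q k powr b / z) = c * cmod (I k) * cmod (a (?Q k)) * ?Q k powr \<alpha> / z" for k
    proof -
      have "?Q k powr \<alpha> = ?Q k powr (\<alpha> - b) * ?Q k powr b" by (simp flip: powr_add)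
      then show ?thesis by (simp add: A_def)
    qed
    moreover have "((\<lambda>k. c * cmod (I k) * cmod (a (?Q k)) * ?Q k powr \<alpha> * (1 / z))
        \<longlongrightarrow> c * cmod 1 * cmod (a 0) * 0 * (1 / z)) at_bot"
      by (intro tendsto_intros I_lim a_lim pow_lim)
    ultimately show ?thesis
      by (simp only: mult_zero_right div_0 times_divide_eq_right mult.right_neutral)
  qed
  have "\<forall>\<^sub>F k in at_bot. A k * (?Q k powr b / z) < 1 / 2"
    using order_tendstoD(2)[OF contr_lim, of "1 / 2"] by simp
  moreover have "\<forall>\<^sub>F k in at_bot. cmod (G (?Q k)) < cmod (G 0) + 1"
    using order_tendstoD(2)[OF tendsto_norm[OF G_lim], of "cmod (G 0) + 1"] by simp
  ultimately have "\<forall>\<^sub>F k in at_bot. A k * (?Q k powr b / z) < 1 / 2 \<and> cmod (G (?Q k)) < cmod (G 0) + 1 \<and> k \<le> N"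
    by (intro eventually_conj eventually_le_at_bot)
  \<comment> \<open>The fixed point argument runs up to \<open>n0\<close>; the recursion over radii
    then covers the exponents up to \<open>N\<close>.\<close>
  then obtain n0 where n0: "\<And>k. k \<le> n0 \<Longrightarrow> A k * (?Q k powr b / z) < 1 / 2 \<and> cmod (G (?Q k)) < cmod (G 0) + 1 \<and> k \<le> N"
    unfolding eventually_at_bot_linorder by blast
  have contr: "A k * (?Q k powr b / (1 - real q powr - b)) \<le> 1 / 2" if "k \<le> n0" for k
    using n0[OF that] by (simp add: z_def)
  have kern_eq: "kern absv q \<alpha> a x y = \<kappa> (absv x) (absv y)" for x y
    by (simp add: \<kappa>_def kern_def)
  have ball: "?Q k = absv x \<Longrightarrow> x \<in> ball_N absv q N \<longleftrightarrow> k \<le> N" for x k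
    by (metis ball_N_def mem_Collect_eq powi_le_iff)

  have "\<exists>v C. v 0 = G 0 \<and> (\<forall>k. cmod (v (?Q k)) \<le> C) \<and>
      (\<forall>k\<le>N. v (?Q k) + volterra \<kappa> v (?Q k) = G (?Q k))"
  proof (rule volterra_solution_extend)
    show "n0 \<le> N" using n0[of n0] by simp
    show "\<exists>v C. v 0 = G 0 \<and> (\<forall>k. cmod (v (?Q k)) \<le> C) \<and>
        (\<forall>k\<le>n0. v (?Q k) + volterra \<kappa> v (?Q k) = G (?Q k))"
      by (rule volterra_solution_small[where A = A and B = "cmod (G 0) + 1", OF b(1) A \<kappa> contr])
        (use n0 in \<open>auto simp: less_imp_le\<close>)
  qed
  then obtain v C where v: "v 0 = G 0" "\<And>k. cmod (v (?Q k)) \<le> C"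
      "\<And>k. k \<le> N \<Longrightarrow> v (?Q k) + volterra \<kappa> v (?Q k) = G (?Q k)"
    by blast
  have C: "C \<ge> 0" using v(2)[of 0] norm_ge_zero order_trans by blast
  have "is_solution absv q M \<alpha> a f N v"
    unfolding is_solution_def radial_continuous_iff
  proof (intro conjI ballI)
    \<comment> \<open>Continuity is a question at the origin only. Since \<open>v\<close> is
      bounded, the integral term tends to 0 and leaves the limit \<open>G 0\<close>, which is
      \<open>v 0\<close>.\<close>
    have vol_lim: "((\<lambda>k. volterra \<kappa> v (?Q k)) \<longlongrightarrow> 0) at_bot"
    proof (rule Lim_null_comparison)
      show "\<forall>\<^sub>F k in at_bot. norm (volterra \<kappa> v (?Q k)) \<le> A k * (?Q k powr b / z) * C"
        unfolding z_def by (intro always_eventually allI norm_volterra_le b A C \<kappa> v(2))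
      show "((\<lambda>k. A k * (?Q k powr b / z) * C) \<longlongrightarrow> 0) at_bot"
        using tendsto_mult_right[OF contr_lim, of C] by simp
    qed
    have "((\<lambda>k. G (?Q k) - volterra \<kappa> v (?Q k)) \<longlongrightarrow> v 0) at_bot"
      using tendsto_diff[OF G_lim vol_lim] v(1) by simp
    moreover have "\<forall>\<^sub>F k in at_bot. G (?Q k) - volterra \<kappa> v (?Q k) = v (?Q k)"
      using eventually_le_at_bot[of N] by eventually_elim (use v(3) in \<open>simp add: algebra_simps\<close>)
    ultimately show "((\<lambda>k. v (?Q k)) \<longlongrightarrow> v 0) at_bot"
      by (rule Lim_transform_eventually)
  next
    fix x assume x: "x \<in> ball_N absv q N"
    have "set_integrable M {y. absv y < absv x} (\<lambda>y. kern absv q \<alpha> a x y * v (absv y)) \<and>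
        v (absv x) + (LINT y:{y. absv y < absv x}|M. kern absv q \<alpha> a x y * v (absv y)) = G (absv x)"
    proof (cases x rule: absv_cases)
      \<comment> \<open>At x = 0 the domain of integration is empty and the equation reads
        \<open>v 0 = G 0\<close>.\<close>
      case 1
      then show ?thesis
        using v(1) by (simp add: not_less set_integrable_def set_lebesgue_integral_def)
    next
      case (2 k)
      then have "k \<le> N" using x ball[of k x] by simp
      then show ?thesis
        using volterra_set_integrable[where v = v and \<kappa> = \<kappa>, OF b(1) A C \<kappa> v(2), of k] v(3)[of k]
        by (simp add: kern_eq 2 volterra_def)
    qed
    then show "set_integrable M {y. absv y < absv x} (\<lambda>y. kern absv q \<alpha> a x y * v (absv y))"
      and "v (absv x) + (LINT y:{y. absv y < absv x}|M. kern absv q \<alpha> a x y * v (absv y))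
        = Fun absv q \<alpha> a f (absv x)"
      by (simp_all add: G_def)
  qed
  moreover have "v (absv x) = w (absv x)"
    if sol: "is_solution absv q M \<alpha> a f N v" "is_solution absv q M \<alpha> a f N w"
      and x: "x \<in> ball_N absv q N" for v w x
  proof -
    have int: "set_integrable M {y. absv y < ?Q k} (\<lambda>y. \<kappa> (?Q k) (absv y) * u (absv y))"
      and eq: "u (?Q k) + volterra \<kappa> u (?Q k) = G (?Q k)"
      if u: "is_solution absv q M \<alpha> a f N u" and k: "k \<le> N" for u k
    proof -
      obtain x where x: "absv x = ?Q k" using ex_absv_eq by blast
      then have "x \<in> ball_N absv q N" using ball[of k x] k by simp
      then show "set_integrable M {y. absv y < ?Q k} (\<lambda>y. \<kappa> (?Q k) (absv y) * u (absv y))"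
        and "u (?Q k) + volterra \<kappa> u (?Q k) = G (?Q k)"
        using u x by (auto simp: is_solution_def kern_eq volterra_def G_def)
    qed
    have zero: "u 0 = G 0" if "is_solution absv q M \<alpha> a f N u" for u
    proof -
      have "0 \<in> ball_N absv q N" by (simp add: ball_N_def less_imp_le)
      then have "u (absv 0) + (LINT y:{y. absv y < absv 0}|M. kern absv q \<alpha> a 0 y * u (absv y))
          = G (absv 0)"
        using that unfolding is_solution_def G_def by blast
      then show ?thesis by (simp add: not_less set_lebesgue_integral_def)
    qed
    define d where "d s = v s - w s" for s
    have d_eq: "d (?Q k) + volterra \<kappa> d (?Q k) = 0" if "k \<le> N" for k
    proof -
      have "volterra \<kappa> d (?Q k) = volterra \<kappa> v (?Q k) - volterra \<kappa> w (?Q k)"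
        unfolding volterra_def d_def using int[OF sol(1) that] int[OF sol(2) that]
        by (simp add: right_diff_distrib)
      moreover have "v (?Q k) = G (?Q k) - volterra \<kappa> v (?Q k)"
        and "w (?Q k) = G (?Q k) - volterra \<kappa> w (?Q k)"
        using eq[OF sol(1) that] eq[OF sol(2) that] by (auto simp only: eq_diff_eq)
      ultimately show ?thesis by (simp add: d_def)
    qed
    \<comment> \<open>Continuity of both solutions at 0 supplies the boundedness that uniqueness
      needs: \<open>d\<close> is bounded up to some \<open>n\<close>, chosen at most
      \<open>n0\<close> so that the contraction estimate holds there too.\<close>
    have "((\<lambda>k. d (?Q k)) \<longlongrightarrow> d 0) at_bot"
      unfolding d_def using sol by (intro tendsto_diff) (auto simp: is_solution_def radial_continuous_iff)
    then have "\<forall>\<^sub>F k in at_bot. cmod (d (?Q k)) < cmod (d 0) + 1"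
      by (rule order_tendstoD(2)[OF tendsto_norm]) simp
    then have "\<forall>\<^sub>F k in at_bot. cmod (d (?Q k)) < cmod (d 0) + 1 \<and> k \<le> n0"
      by (intro eventually_conj eventually_le_at_bot)
    then obtain n where n: "\<And>k. k \<le> n \<Longrightarrow> cmod (d (?Q k)) < cmod (d 0) + 1 \<and> k \<le> n0"
      unfolding eventually_at_bot_linorder by blast
    have n_le: "n \<le> n0" "n0 \<le> N" using n[of n] n0[of n0] by auto
    have d_0: "d (?Q k) = 0" if "k \<le> N" for k
    proof (rule volterra_homogeneous_unique[where A = A and \<kappa> = \<kappa> and n = n and m = N
          and B = "cmod (d 0) + 1" and d = d, OF b(1) A \<kappa>])
      show "cmod (d (?Q k)) \<le> cmod (d 0) + 1" if "k \<le> n" for k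
        using n[OF that] by simp
    qed (use n_le contr d_eq that in auto)
    show ?thesis
    proof (cases x rule: absv_cases)
      case 1
      then show ?thesis using zero[OF sol(1)] zero[OF sol(2)] by simp
    next
      case (2 k)
      then have "k \<le> N" using x ball[of k x] by simp
      then show ?thesis using d_0[of k] 2 by (simp add: d_def)
    qed
  qed
  ultimately show ?thesis by blast
qed

end
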